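(* Let $\ell\ge 2$ and let $k_1,\dots,k_\ell$ be arbitrary real numbers with $k_1+\dots+k_\ell=0$. Then $$G(k_1,\dots,k_\ell)=\begin{cases}\frac12|k_1|=\frac12|k_2| & \text{if }\ell=2,\\ 0 & \text{if }\ell>2.\end{cases}$$
   Context: For real numbers $k_1,\dots,k_\ell$, the function $G$ is defined by $$G(k_1,\dots,k_\ell):=\sum_{\sigma\in S_\ell}\ \sum_{m=1}^{\ell}\frac{(-1)^m}{m}\sum_{\substack{\ell_1+\dots+\ell_m=\ell\\ \ell_1\ge 1,\dots,\ell_m\ge 1}}\frac{1}{\ell_1!\cdots\ell_m!}\,\max\Bigl(0,\ \sum_{i=1}^{\ell_1}k_{\sigma(i)},\ \sum_{i=1}^{\ell_1+\ell_2}k_{\sigma(i)},\ \dots,\ \sum_{i=1}^{\ell_1+\dots+\ell_{m-1}}k_{\sigma(i)}\Bigr),$$ where $S_\ell$ is the symmetric group on $\{1,\dots,\ell\}$, the inner sum is over ordered $m$-tuples of positive integers, and for $m=1$ the maximum is $\max(0)=0$. *)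

theory Defs
  imports Complex_Main "HOL-Combinatorics.Permutations"
begin

definition compositions :: "nat \<Rightarrow> nat \<Rightarrow> nat list set" where
  "compositions m l = {ls. length ls = m \<and> sum_list ls = l \<and> (\<forall>x\<in>set ls. x \<ge> 1)}"

(* The sum over compositions in G is therefore a genuine finite sum. *)
lemma finite_compositions: "finite (compositions m l)"
proof (rule finite_subset)
  show "compositions m l \<subseteq> {ls. set ls \<subseteq> {..l} \<and> length ls = m}"
    by (auto simp: compositions_def dest: member_le_sum_list)
  show "finite {ls. set ls \<subseteq> {..l} \<and> length ls = m}"
    by (rule finite_lists_length_eq) simp
qed

(* sum_list (take j ls) is the partial sum of the first j parts of ls; only the values
   k 1, ..., k l matter, since a permutation of {1..l} maps {1..l} to itself. *)
definition max_partial_sum :: "(nat \<Rightarrow> real) \<Rightarrow> (nat \<Rightarrow> nat) \<Rightarrow> nat list \<Rightarrow> real" where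
  "max_partial_sum k \<sigma> ls =
     Max (insert 0 ((\<lambda>j. \<Sum>i = 1..sum_list (take j ls). k (\<sigma> i)) ` {1..<length ls}))"

definition G :: "nat \<Rightarrow> (nat \<Rightarrow> real) \<Rightarrow> real" where
  "G l k =
     (\<Sum>\<sigma> | \<sigma> permutes {1..l}. \<Sum>m = 1..l. (-1) ^ m / real m *
        (\<Sum>ls\<in>compositions m l. 1 / (\<Prod>x\<leftarrow>ls. fact x) * max_partial_sum k \<sigma> ls))"

end

theory Submission
  imports Defs "HOL-Computational_Algebra.Polynomial"
begin

text \<open>
  A pair of a permutation and a composition with \<open>m\<close> parts induces a surjection \<open>f\<close> from \<open>{1..l}\<close>
  onto the \<open>m\<close> block labels, and each surjection arises from exactly as many permutations as the
  product of factorials in the denominator. So \<open>G\<close> is the sum over \<open>m\<close> of \<open>(-1)^m / m * P m\<close>, where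
  \<open>P m\<close> sums, over the surjections, the maximum of the partial sums of the block sums. On the other
  hand, the same sum \<open>W n\<close> over all functions into \<open>n\<close> labels equals \<open>\<Sum>m. (n choose m) * P m\<close>; it is
  a polynomial in \<open>n\<close> whose linear coefficient is \<open>- G\<close>.

  The block sums of a uniformly random function are exchangeable, so Spitzer's identity applies:
  \<open>W n\<close> is the sum over \<open>j \<le> n\<close> of \<open>1 / j\<close> times the sum of the positive parts of the \<open>j\<close>-th partial
  sums. As the total is 0, the positive part may be replaced by half the absolute value, and the
  symmetry \<open>j \<mapsto> n - j\<close> gives
  \<open>W n = n / 4 * (\<Sum>U. \<bar>k(U)\<bar> * (\<Sum>j = 1..<n. j ^ (u - 1) * (n - j) ^ (v - 1)))\<close>, summed over the
  proper nonempty subsets \<open>U\<close>, where \<open>u\<close> and \<open>v\<close> are the sizes of \<open>U\<close> and of its complement. The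
  polynomial in \<open>n\<close> given by the inner sum vanishes at 0 unless \<open>u = v = 1\<close>, when it is \<open>n - 1\<close>.
\<close>

section \<open>Spitzer's identity for exchangeable variables\<close>

text \<open>Both the empty sum \<open>t = 0\<close> and the full sum \<open>t = n\<close> take part,
  as Spitzer's identity requires. \<open>max_partial_sum\<close> stops before the full sum; the two
  agree once the total is 0.\<close>

definition running_max :: "(nat \<Rightarrow> real) \<Rightarrow> nat \<Rightarrow> real" where
  "running_max x n = Max ((\<lambda>t. \<Sum>i<t. x i) ` {..n})"

lemma running_max_0 [simp]: "running_max x 0 = 0"
  by (simp add: running_max_def)

lemma running_max_ge: "t \<le> n \<Longrightarrow> (\<Sum>i<t. x i) \<le> running_max x n"
  by (auto simp: running_max_def intro: Max_ge)

lemma running_max_nonneg: "0 \<le> running_max x n"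
  using running_max_ge[of 0 n x] by simp

lemma running_max_Suc: "running_max x (Suc n) = max (\<Sum>i<Suc n. x i) (running_max x n)"
  unfolding running_max_def atMost_Suc image_insert by (rule Max_insert) auto

text \<open>A prefix is either empty or consists of \<open>x 0\<close> and a prefix of the walk that
  starts after the first step.\<close>

lemma running_max_Suc_shift:
  "running_max x (Suc n) = max 0 (x 0 + running_max (\<lambda>i. x (Suc i)) n)"
proof (induction n)
  case 0
  then show ?case by (simp add: running_max_Suc)
next
  case (Suc n)
  have "running_max x (Suc (Suc n)) =
      max (x 0 + (\<Sum>i<Suc n. x (Suc i))) (max 0 (x 0 + running_max (\<lambda>i. x (Suc i)) n))"
    by (simp only: running_max_Suc[of x "Suc n"] Suc.IH sum.lessThan_Suc_shift[of x "Suc n"])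
  then show ?case
    by (simp add: running_max_Suc[of "\<lambda>i. x (Suc i)" n] max_def del: sum.lessThan_Suc)
qed

lemma running_max_cong:
  assumes "\<And>i. i < n \<Longrightarrow> x i = y i"
  shows "running_max x n = running_max y n"
proof -
  have "(\<Sum>i<t. x i) = (\<Sum>i<t. y i)" if "t \<le> n" for t
    using assms that by (intro sum.cong) auto
  then show ?thesis
    unfolding running_max_def by (intro arg_cong[where f = Max] image_cong) auto
qed

lemma running_max_Suc_cases:
  assumes "\<And>i. i < n \<Longrightarrow> c i = Suc i"
  shows "running_max x (Suc n) =
    (if 0 < (\<Sum>i<Suc n. x i) then x 0 + running_max (x \<circ> c) n else running_max x n)"
proof -
  have shift: "running_max (x \<circ> c) n = running_max (\<lambda>i. x (Suc i)) n"
    using assms by (intro running_max_cong) auto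
  have "(\<Sum>i<Suc n. x i) \<le> running_max x (Suc n)"
    by (rule running_max_ge) simp
  then show ?thesis
    using running_max_Suc_shift[of x n] running_max_Suc[of x n] running_max_nonneg[of x n] shift
    by (auto simp: max_def split: if_splits)
qed

text \<open>\<open>F\<close> serves as a sample space with counting measure, so sums over
  \<open>F\<close> replace expectations. Invariance in distribution is witnessed by a bijection
  \<open>T\<close> of the sample space.\<close>

definition exchangeable :: "nat \<Rightarrow> 'f set \<Rightarrow> ('f \<Rightarrow> nat \<Rightarrow> real) \<Rightarrow> bool" where
  "exchangeable N F X \<longleftrightarrow>
     (\<forall>p. p permutes {..<N} \<longrightarrow> (\<exists>T. bij_betw T F F \<and> (\<forall>f\<in>F. X (T f) = X f \<circ> p)))"

lemma exchangeable_sum: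
  assumes "exchangeable N F X" "p permutes {..<N}"
  shows "(\<Sum>f\<in>F. \<phi> (X f \<circ> p)) = (\<Sum>f\<in>F. \<phi> (X f))"
proof -
  obtain T where T: "bij_betw T F F" "\<And>f. f \<in> F \<Longrightarrow> X (T f) = X f \<circ> p"
    using assms unfolding exchangeable_def by blast
  have "(\<Sum>f\<in>F. \<phi> (X f)) = (\<Sum>f\<in>F. \<phi> (X (T f)))"
    by (rule sum.reindex_bij_betw[OF T(1), symmetric])
  also have "\<dots> = (\<Sum>f\<in>F. \<phi> (X f \<circ> p))"
    by (intro sum.cong) (simp_all add: T(2))
  finally show ?thesis ..
qed

text \<open>Exchangeability is applied to the transposition of \<open>i\<close> and
  \<open>j\<close>. Invariance of \<open>\<psi>\<close> is asked only for permutations moving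
  nothing else, because the weight in \<open>spitzer_step\<close> is symmetric in an initial segment
  of the variables only.\<close>

lemma exchangeable_sum_symmetric:
  assumes ex: "exchangeable N F X" and "i < N" "j < N"
    and sym: "\<And>x p. p permutes {..<N} \<Longrightarrow> (\<And>a. a \<noteq> i \<Longrightarrow> a \<noteq> j \<Longrightarrow> p a = a) \<Longrightarrow> \<psi> (x \<circ> p) = \<psi> x"
  shows "(\<Sum>f\<in>F. \<psi> (X f) * X f i) = (\<Sum>f\<in>F. \<psi> (X f) * X f j)"
proof -
  let ?p = "transpose i j"
  have p: "?p permutes {..<N}"
    using assms by (intro permutes_swap_id) auto
  have "(\<Sum>f\<in>F. \<psi> (X f \<circ> ?p) * (X f \<circ> ?p) i) = (\<Sum>f\<in>F. \<psi> (X f) * X f i)"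
    using exchangeable_sum[OF ex p, of "\<lambda>x. \<psi> x * x i"] by simp
  moreover have "\<psi> (X f \<circ> ?p) = \<psi> (X f)" for f
    by (rule sym[OF p]) (simp add: transpose_def)
  ultimately show ?thesis by simp
qed

text \<open>The cyclic shift of the first \<^term>\<open>Suc n\<close> variables turns the maximum over the walk started
  after its first step into the maximum over the first \<^term>\<open>n\<close> steps.\<close>

lemma spitzer_step:
  assumes ex: "exchangeable N F X" and n: "Suc n \<le> N"
  shows "(\<Sum>f\<in>F. running_max (X f) (Suc n)) =
    (\<Sum>f\<in>F. running_max (X f) n) + 1 / real (Suc n) * (\<Sum>f\<in>F. max 0 (\<Sum>i<Suc n. X f i))"
proof -
  define c where "c = (\<lambda>i. if i < n then Suc i else if i = n then 0 else i)"
  have "bij_betw c {..<Suc n} {..<Suc n}"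
    by (rule bij_betwI[where g = "\<lambda>i. if i = 0 then n else i - 1"]) (auto simp: c_def)
  then have c': "c permutes {..<Suc n}"
    by (rule bij_imp_permutes) (auto simp: c_def)
  then have c: "c permutes {..<N}"
    by (rule permutes_subset) (use n in auto)
  \<comment> \<open>Indicator of the case distinction in \<open>running_max_Suc_cases\<close>. It is
    symmetric in the first \<open>Suc n\<close> variables, so the cyclic shift \<open>c\<close>
    leaves it unchanged.\<close>
  define pos where "pos x = (if 0 < (\<Sum>i<Suc n. x i) then 1 else 0 :: real)" for x :: "nat \<Rightarrow> real"
  have pos_perm: "pos (x \<circ> p) = pos x" if "p permutes {..<Suc n}" for x p
    using sum.permute[OF that, of x] unfolding pos_def by simp
  have "(\<Sum>f\<in>F. running_max (X f) (Suc n)) =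
      (\<Sum>f\<in>F. pos (X f) * X f 0) + (\<Sum>f\<in>F. pos (X f) * running_max (X f \<circ> c) n) +
      (\<Sum>f\<in>F. (1 - pos (X f)) * running_max (X f) n)"
    unfolding sum.distrib[symmetric]
    by (intro sum.cong refl, subst running_max_Suc_cases[of n c])
       (auto simp: c_def pos_def)
  also have "(\<Sum>f\<in>F. pos (X f) * running_max (X f \<circ> c) n) = (\<Sum>f\<in>F. pos (X f) * running_max (X f) n)"
    using exchangeable_sum[OF ex c, of "\<lambda>x. pos x * running_max x n"] by (simp add: pos_perm[OF c'])
  \<comment> \<open>Each of the first \<open>Suc n\<close> variables has the same
    \<open>pos\<close>-weighted sum as \<open>X f 0\<close>, which is therefore the average; the
    total of these sums is that of the positive parts.\<close>
  also have "(\<Sum>f\<in>F. pos (X f) * X f 0) = 1 / real (Suc n) * (\<Sum>f\<in>F. max 0 (\<Sum>i<Suc n. X f i))"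
  proof -
    have "(\<Sum>f\<in>F. pos (X f) * X f i) = (\<Sum>f\<in>F. pos (X f) * X f 0)" if "i < Suc n" for i
    proof (rule exchangeable_sum_symmetric[OF ex])
      fix x p
      assume p: "p permutes {..<N}" "\<And>a. a \<noteq> i \<Longrightarrow> a \<noteq> 0 \<Longrightarrow> p a = a"
      have "p permutes {..<Suc n}"
        by (rule permutes_superset[OF p(1)]) (use p(2) that in auto)
      then show "pos (x \<circ> p) = pos x" by (rule pos_perm)
    qed (use that n in auto)
    then have "(\<Sum>i<Suc n. \<Sum>f\<in>F. pos (X f) * X f i) =
        (\<Sum>i<Suc n. \<Sum>f\<in>F. pos (X f) * X f 0)"
      by (rule sum.cong[OF refl]) simp
    also have "\<dots> = real (Suc n) * (\<Sum>f\<in>F. pos (X f) * X f 0)"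
      by (simp only: sum_constant card_lessThan)
    finally have "(\<Sum>i<Suc n. \<Sum>f\<in>F. pos (X f) * X f i) = real (Suc n) * (\<Sum>f\<in>F. pos (X f) * X f 0)" .
    moreover have "pos x * (\<Sum>i<Suc n. x i) = max 0 (\<Sum>i<Suc n. x i)" for x
      by (simp add: pos_def del: sum.lessThan_Suc)
    then have "(\<Sum>i<Suc n. \<Sum>f\<in>F. pos (X f) * X f i) = (\<Sum>f\<in>F. max 0 (\<Sum>i<Suc n. X f i))"
      by (subst sum.swap) (simp only: sum_distrib_left[symmetric])
    ultimately show ?thesis by (simp add: field_simps del: sum.lessThan_Suc)
  qed
  finally show ?thesis
    by (simp add: left_diff_distrib sum_subtractf del: sum.lessThan_Suc)
qed

lemma spitzer:
  assumes "exchangeable N F X" "n \<le> N"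
  shows "(\<Sum>f\<in>F. running_max (X f) n) =
    (\<Sum>j=1..n. 1 / real j * (\<Sum>f\<in>F. max 0 (\<Sum>i<j. X f i)))"
  using assms(2)
proof (induction n)
  case (Suc n)
  then show ?case by (subst spitzer_step[OF assms(1)]) simp_all
qed simp

text \<open>All variables have the same mean, and \<open>N\<close> times this mean is 0.\<close>

lemma exchangeable_partial_sum_zero:
  assumes ex: "exchangeable N F X" and zero: "\<And>f. f \<in> F \<Longrightarrow> (\<Sum>i<N. X f i) = 0" and "j \<le> N"
  shows "(\<Sum>f\<in>F. \<Sum>i<j. X f i) = 0"
proof (cases "N = 0")
  case False
  have eq: "(\<Sum>f\<in>F. X f i) = (\<Sum>f\<in>F. X f 0)" if "i < N" for i
  proof -
    have "(\<Sum>f\<in>F. 1 * X f i) = (\<Sum>f\<in>F. 1 * X f 0)"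
      by (rule exchangeable_sum_symmetric[OF ex that]) (use False in auto)
    then show ?thesis by (simp only: mult_1)
  qed
  have "(\<Sum>i<N. \<Sum>f\<in>F. X f i) = (\<Sum>i<N. \<Sum>f\<in>F. X f 0)"
    by (rule sum.cong[OF refl]) (rule eq, simp)
  then have "real N * (\<Sum>f\<in>F. X f 0) = (\<Sum>i<N. \<Sum>f\<in>F. X f i)"
    by (simp only: sum_constant card_lessThan)
  also have "\<dots> = 0"
    by (subst sum.swap) (simp add: zero)
  finally have "(\<Sum>f\<in>F. X f 0) = 0" using False by simp
  then have "(\<Sum>f\<in>F. X f i) = 0" if "i < N" for i
    by (rule trans[OF eq[OF that]])
  then have "(\<Sum>i<j. \<Sum>f\<in>F. X f i) = 0"
    using \<open>j \<le> N\<close> by simp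
  then show ?thesis by (subst sum.swap)
next
  case True
  with \<open>j \<le> N\<close> show ?thesis by simp
qed

section \<open>Block sums of all functions into \<open>n\<close> labels\<close>

definition block_sum :: "('a \<Rightarrow> real) \<Rightarrow> 'a set \<Rightarrow> ('a \<Rightarrow> nat) \<Rightarrow> nat \<Rightarrow> real" where
  "block_sum k A f i = (\<Sum>a | a \<in> A \<and> f a = i. k a)"

lemma sum_block_sum:
  assumes "finite A"
  shows "(\<Sum>i<t. block_sum k A f i) = (\<Sum>a | a \<in> A \<and> f a < t. k a)"
proof -
  have "(\<Sum>i<t. \<Sum>a | a \<in> {a. a \<in> A \<and> f a < t} \<and> f a = i. k a) = (\<Sum>a | a \<in> A \<and> f a < t. k a)"
    by (rule sum.group) (use assms in auto)
  moreover have "(\<Sum>i<t. block_sum k A f i) = (\<Sum>i<t. \<Sum>a | a \<in> {a. a \<in> A \<and> f a < t} \<and> f a = i. k a)"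
    unfolding block_sum_def by (intro sum.cong) auto
  ultimately show ?thesis by simp
qed

text \<open>Permuting the labels permutes the blocks: block \<open>i\<close> of
  \<open>inv p \<circ> f\<close> is block \<open>p i\<close> of \<open>f\<close>.\<close>

lemma exchangeable_block_sum:
  fixes A :: "'a set"
  shows "exchangeable N (A \<rightarrow>\<^sub>E {..<N}) (block_sum k A)"
  unfolding exchangeable_def
proof (intro allI impI exI conjI ballI)
  fix p :: "nat \<Rightarrow> nat"
  assume p: "p permutes {..<N}"
  let ?T = "\<lambda>q f. restrict (q \<circ> f) A :: 'a \<Rightarrow> nat"
  have ip: "inv p permutes {..<N}" using p by (rule permutes_inv)
  have inN: "q x \<in> {..<N}" if "q permutes {..<N}" "x < N" for q x
    using permutes_in_image[OF that(1)] that(2) by blast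
  show "bij_betw (?T (inv p)) (A \<rightarrow>\<^sub>E {..<N}) (A \<rightarrow>\<^sub>E {..<N})"
  proof (rule bij_betwI[where g = "?T p"])
    fix f assume f: "f \<in> A \<rightarrow>\<^sub>E {..<N}"
    show "?T p (?T (inv p) f) = f" "?T (inv p) (?T p f) = f"
      using f permutes_inverses[OF p]
      by (auto simp: fun_eq_iff restrict_def PiE_def extensional_def)
  qed (use inN[OF p] inN[OF ip] in \<open>auto simp: PiE_iff\<close>)
  fix f assume f: "f \<in> A \<rightarrow>\<^sub>E {..<N}"
  show "block_sum k A (?T (inv p) f) = block_sum k A f \<circ> p"
    unfolding block_sum_def comp_def
    by (intro ext sum.cong) (use permutes_inverses[OF p] in auto)
qed

lemma card_funcset_below:
  assumes "finite A" "U \<subseteq> A" "j \<le> n"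
  shows "card {f \<in> A \<rightarrow>\<^sub>E {..<n}. {a \<in> A. f a < j} = U} = j ^ card U * (n - j) ^ card (A - U)"
proof -
  have "{f \<in> A \<rightarrow>\<^sub>E {..<n}. {a \<in> A. f a < j} = U} = PiE A (\<lambda>a. if a \<in> U then {..<j} else {j..<n})"
  proof (intro equalityI subsetI)
    fix f assume f: "f \<in> {f \<in> A \<rightarrow>\<^sub>E {..<n}. {a \<in> A. f a < j} = U}"
    then have "f a \<in> (if a \<in> U then {..<j} else {j..<n})" if "a \<in> A" for a
      using that by (auto simp: PiE_iff not_less[symmetric])
    with f show "f \<in> PiE A (\<lambda>a. if a \<in> U then {..<j} else {j..<n})"
      by (simp add: PiE_iff)
  next
    fix f assume f: "f \<in> PiE A (\<lambda>a. if a \<in> U then {..<j} else {j..<n})"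
    then have *: "f a < n \<and> (f a < j \<longleftrightarrow> a \<in> U)" if "a \<in> A" for a
      using that \<open>j \<le> n\<close> PiE_mem[OF f that] by (auto split: if_splits)
    with f \<open>U \<subseteq> A\<close> show "f \<in> {f \<in> A \<rightarrow>\<^sub>E {..<n}. {a \<in> A. f a < j} = U}"
      by (auto simp: PiE_iff)
  qed
  moreover have "A \<inter> {a. a \<in> U} = U" "A \<inter> - {a. a \<in> U} = A - U"
    using \<open>U \<subseteq> A\<close> by auto
  ultimately show ?thesis
    using \<open>finite A\<close> by (simp add: card_PiE if_distrib[of card] prod.If_cases)
qed

text \<open>Functions are grouped by the set \<open>U\<close> of points with label below
  \<open>j\<close>; the partial sum depends on \<open>U\<close> alone.\<close>

lemma sum_abs_partial_sum:
  assumes "finite A" "j \<le> n"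
  shows "(\<Sum>f \<in> A \<rightarrow>\<^sub>E {..<n}. \<bar>\<Sum>i<j. block_sum k A f i\<bar>) =
    (\<Sum>U\<in>Pow A. \<bar>sum k U\<bar> * (real j ^ card U * real (n - j) ^ card (A - U)))"
proof -
  let ?F = "A \<rightarrow>\<^sub>E {..<n}"
  have "(\<Sum>f\<in>?F. \<bar>\<Sum>i<j. block_sum k A f i\<bar>) =
      (\<Sum>U\<in>Pow A. \<Sum>f\<in>{f \<in> ?F. {a \<in> A. f a < j} = U}. \<bar>\<Sum>i<j. block_sum k A f i\<bar>)"
    by (rule sum.group[symmetric]) (use assms in \<open>auto intro!: finite_PiE\<close>)
  also have "\<dots> = (\<Sum>U\<in>Pow A. \<Sum>f\<in>{f \<in> ?F. {a \<in> A. f a < j} = U}. \<bar>sum k U\<bar>)"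
    using assms by (intro sum.cong) (auto simp: sum_block_sum)
  also have "\<dots> = (\<Sum>U\<in>Pow A. \<bar>sum k U\<bar> * (real j ^ card U * real (n - j) ^ card (A - U)))"
    using assms by (intro sum.cong) (auto simp: card_funcset_below)
  finally show ?thesis .
qed

lemma sum_running_max:
  assumes A: "finite A" and zero: "sum k A = 0"
  shows "(\<Sum>f \<in> A \<rightarrow>\<^sub>E {..<n}. running_max (block_sum k A f) n) =
    real n / 4 * (\<Sum>U\<in>Pow A - {{}, A}. \<bar>sum k U\<bar> *
      (\<Sum>j = 1..<n. real j ^ (card U - 1) * real (n - j) ^ (card (A - U) - 1)))"
proof (cases "n = 0")
  case False
  let ?F = "A \<rightarrow>\<^sub>E {..<n}"
  define S where "S f j = (\<Sum>i<j. block_sum k A f i)" for f j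
  define w where "w U j = \<bar>sum k U\<bar> * (real j ^ card U * real (n - j) ^ card (A - U))" for U j
  define D where "D j = (\<Sum>U\<in>Pow A. w U j)" for j
  have total: "S f n = 0" if "f \<in> ?F" for f
  proof -
    have "{a \<in> A. f a < n} = A" using that by auto
    then show ?thesis by (simp add: S_def sum_block_sum[OF A] zero)
  qed
  have D_abs: "(\<Sum>f\<in>?F. \<bar>S f j\<bar>) = D j" if "j \<le> n" for j
    unfolding S_def D_def w_def by (rule sum_abs_partial_sum[OF A that])
  have "D n = (\<Sum>f\<in>?F. \<bar>S f n\<bar>)" by (simp only: D_abs)
  also have "\<dots> = 0" using total by simp
  finally have "D n = 0" .
  \<comment> \<open>Complementation \<open>U \<mapsto> A - U\<close> exchanges the two powers and,
    as the total is 0, preserves \<open>\<bar>sum k U\<bar>\<close>.\<close>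
  have D_sym: "D (n - j) = D j" if "j \<le> n" for j
    unfolding D_def
  proof (rule sum.reindex_bij_witness[where i = "\<lambda>U. A - U" and j = "\<lambda>U. A - U"])
    fix U assume U: "U \<in> Pow A"
    have "sum k (A - U) = - sum k U"
      using sum.subset_diff[of U A k] U A zero by auto
    moreover have "A - (A - U) = U" using U by auto
    ultimately show "w (A - U) j = w U (n - j)"
      using that by (simp add: w_def mult.commute)
  qed auto
  have half: "(\<Sum>f\<in>?F. max 0 (S f j)) = D j / 2" if "j \<le> n" for j
  proof -
    have "max 0 x = (x + \<bar>x\<bar>) / 2" for x :: real by auto
    then have "(\<Sum>f\<in>?F. max 0 (S f j)) = ((\<Sum>f\<in>?F. S f j) + (\<Sum>f\<in>?F. \<bar>S f j\<bar>)) / 2"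
      by (simp only: sum_divide_distrib[symmetric] sum.distrib)
    moreover have "(\<Sum>f\<in>?F. S f j) = 0"
      unfolding S_def
      by (rule exchangeable_partial_sum_zero[OF exchangeable_block_sum _ that])
         (use total in \<open>simp add: S_def\<close>)
    ultimately show ?thesis by (simp add: D_abs[OF that])
  qed
  have split: "{1..n} = insert n {1..<n}" using False by auto
  have "(\<Sum>f\<in>?F. running_max (block_sum k A f) n) = (\<Sum>j=1..n. 1 / real j * (D j / 2))"
    unfolding spitzer[OF exchangeable_block_sum order_refl] S_def[symmetric]
    by (intro sum.cong) (auto simp: half)
  \<comment> \<open>The endpoint \<open>j = n\<close>, where \<open>D\<close> vanishes, is removed
    so that the reflection \<open>j \<mapsto> n - j\<close> maps the range to itself.\<close>
  also have "\<dots> = (\<Sum>j=1..<n. 1 / real j * (D j / 2))"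
    unfolding split by (simp add: \<open>D n = 0\<close>)
  finally have W1: "(\<Sum>f\<in>?F. running_max (block_sum k A f) n) = (\<Sum>j=1..<n. 1 / real j * (D j / 2))" .
  have W2: "(\<Sum>j=1..<n. 1 / real j * (D j / 2)) = (\<Sum>j=1..<n. 1 / real (n - j) * (D j / 2))"
    by (rule sum.reindex_bij_witness[where i = "\<lambda>j. n - j" and j = "\<lambda>j. n - j"]) (auto simp: D_sym)
  \<comment> \<open>The sum is averaged with its reflection, using
    \<open>1 / j + 1 / (n - j) = n / (j * (n - j))\<close>.\<close>
  have "2 * (\<Sum>j=1..<n. 1 / real j * (D j / 2)) =
      (\<Sum>j=1..<n. 1 / real j * (D j / 2) + 1 / real (n - j) * (D j / 2))"
    by (simp only: sum.distrib W2[symmetric] mult_2)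
  also have "\<dots> = (\<Sum>j=1..<n. real n / 2 * (D j / (real j * real (n - j))))"
    by (intro sum.cong) (auto simp: field_simps of_nat_diff)
  finally have W3: "(\<Sum>j=1..<n. 1 / real j * (D j / 2)) =
      real n / 4 * (\<Sum>j=1..<n. D j / (real j * real (n - j)))"
    by (simp only: sum_distrib_left[symmetric])
  have "D j / (real j * real (n - j)) =
      (\<Sum>U\<in>Pow A - {{}, A}. \<bar>sum k U\<bar> * (real j ^ (card U - 1) * real (n - j) ^ (card (A - U) - 1)))"
    if j: "j \<in> {1..<n}" for j
  proof -
    have "D j = (\<Sum>U\<in>Pow A - {{}, A}. w U j)"
      unfolding D_def by (rule sum.mono_neutral_right) (use A zero in \<open>auto simp: w_def\<close>)
    \<comment> \<open>Both \<open>U\<close> and its complement are nonempty, so the division lowers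
      each exponent by one without truncated subtraction.\<close>
    moreover have "w U j / (real j * real (n - j)) =
        \<bar>sum k U\<bar> * (real j ^ (card U - 1) * real (n - j) ^ (card (A - U) - 1))"
      if "U \<in> Pow A - {{}, A}" for U
    proof -
      have "finite U" "finite (A - U)" "U \<noteq> {}" "A - U \<noteq> {}"
        using that A by (auto intro: finite_subset)
      then obtain u v where "card U = Suc u" "card (A - U) = Suc v"
        by (metis card_eq_0_iff not0_implies_Suc)
      then show ?thesis using j by (simp add: w_def)
    qed
    ultimately show ?thesis by (simp add: sum_divide_distrib)
  qed
  then have "(\<Sum>j=1..<n. D j / (real j * real (n - j))) =
      (\<Sum>j=1..<n. \<Sum>U\<in>Pow A - {{}, A}. \<bar>sum k U\<bar> *
        (real j ^ (card U - 1) * real (n - j) ^ (card (A - U) - 1)))"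
    by (rule sum.cong[OF refl])
  then show ?thesis
    unfolding W1 W3 by (subst (asm) sum.swap) (simp only: sum_distrib_left)
qed simp

section \<open>Linear coefficients of polynomials given by their values\<close>

text \<open>Telescoping \<open>(j + 1) ^ (r + 1) - j ^ (r + 1)\<close> expresses
  \<open>n ^ (r + 1)\<close> by the power sums of exponent at most \<open>r\<close>; the one of
  exponent \<open>r\<close> has coefficient \<open>r + 1\<close> and can be solved for.\<close>

lemma power_sum_poly:
  "\<exists>p :: real poly. \<forall>n. poly p (real n) = (\<Sum>j<n. real j ^ r)"
proof (induction r rule: less_induct)
  case (less r)
  then obtain q where q: "\<And>i n. i < r \<Longrightarrow> poly (q i) (real n) = (\<Sum>j<n. real j ^ i)"
    by metis
  define p where "p = smult (1 / real (Suc r)) (monom 1 (Suc r) - (\<Sum>i<r. smult (real (Suc r choose i)) (q i)))"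
  have "poly p (real n) = (\<Sum>j<n. real j ^ r)" for n
  proof -
    have "real n ^ Suc r = (\<Sum>j<n. real (Suc j) ^ Suc r - real j ^ Suc r)"
      by (subst sum_lessThan_telescope) simp
    also have "\<dots> = (\<Sum>j<n. \<Sum>i\<le>r. real (Suc r choose i) * real j ^ i)"
    proof (intro sum.cong refl)
      fix j
      have "real (Suc j) ^ Suc r = (\<Sum>i\<le>Suc r. real (Suc r choose i) * real j ^ i)"
        using binomial_ring[of "real j" 1 "Suc r"] by (simp add: add.commute)
      then show "real (Suc j) ^ Suc r - real j ^ Suc r = (\<Sum>i\<le>r. real (Suc r choose i) * real j ^ i)"
        by simp
    qed
    also have "\<dots> = (\<Sum>i\<le>r. real (Suc r choose i) * (\<Sum>j<n. real j ^ i))"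
      by (subst sum.swap) (simp add: sum_distrib_left)
    also have "\<dots> = (\<Sum>i<r. real (Suc r choose i) * (\<Sum>j<n. real j ^ i)) + real (Suc r) * (\<Sum>j<n. real j ^ r)"
      by (simp add: lessThan_Suc_atMost[symmetric] del: power_Suc)
    finally show ?thesis
      by (simp add: p_def poly_sum poly_monom q)
  qed
  then show ?case by blast
qed

text \<open>Expanding \<open>(n - j) ^ b\<close> reduces the claim to power sums. Agreement is
  stated for \<open>n > 0\<close> only: at 0 the sum is empty, but the polynomial can take the value
  -1, which is what survives in \<open>G\<close>.\<close>

lemma power_convolution_poly:
  "\<exists>p :: real poly. poly p 0 = (if a = 0 \<and> b = 0 then - 1 else 0) \<and>
     (\<forall>n>0. poly p (real n) = (\<Sum>j = 1..<n. real j ^ a * real (n - j) ^ b))"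
proof -
  obtain q where q: "\<And>i n. poly (q i) (real n) = (\<Sum>j<n. real j ^ i)"
    using power_sum_poly by metis
  define t where "t = (\<Sum>i\<le>b. smult (real (b choose i) * (- 1) ^ (b - i)) (monom 1 i * q (a + (b - i))))"
  have t: "poly t (real n) = (\<Sum>j<n. real j ^ a * real (n - j) ^ b)" for n
  proof -
    have "(\<Sum>j<n. real j ^ a * real (n - j) ^ b) =
        (\<Sum>j<n. \<Sum>i\<le>b. real (b choose i) * (- 1) ^ (b - i) * (real n ^ i * real j ^ (a + (b - i))))"
    proof (intro sum.cong refl)
      fix j assume "j \<in> {..<n}"
      then have "real (n - j) ^ b = (\<Sum>i\<le>b. real (b choose i) * real n ^ i * (- real j) ^ (b - i))"
        using binomial_ring[of "real n" "- real j" b] by (simp add: of_nat_diff)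
      then show "real j ^ a * real (n - j) ^ b =
          (\<Sum>i\<le>b. real (b choose i) * (- 1) ^ (b - i) * (real n ^ i * real j ^ (a + (b - i))))"
        by (simp only: sum_distrib_left power_add power_minus[of "real j"] mult_ac)
    qed
    also have "\<dots> = poly t (real n)"
      by (subst sum.swap) (simp add: t_def poly_sum poly_monom q sum_distrib_left)
    finally show ?thesis ..
  qed
  \<comment> \<open>The range \<open>j < n\<close> of \<open>t\<close> includes
    \<open>j = 0\<close>, whose term \<open>0 ^ a * n ^ b\<close> is nonzero as a polynomial only
    for \<open>a = 0\<close>. As \<open>t\<close> vanishes at 0, subtracting this term gives -1
    there exactly when \<open>a = b = 0\<close>.\<close>
  define p where "p = t - (if a = 0 then monom 1 b else 0)"
  have "poly p 0 = (if a = 0 \<and> b = 0 then - 1 else 0)"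
    using t[of 0] by (auto simp: p_def poly_monom)
  moreover have "poly p (real n) = (\<Sum>j = 1..<n. real j ^ a * real (n - j) ^ b)" if "n > 0" for n
  proof -
    have "{..<n} = insert 0 {1..<n}" using that by auto
    then have "(\<Sum>j<n. real j ^ a * real (n - j) ^ b) =
        0 ^ a * real n ^ b + (\<Sum>j = 1..<n. real j ^ a * real (n - j) ^ b)"
      by simp
    then show ?thesis by (simp add: p_def t poly_monom)
  qed
  ultimately show ?thesis by blast
qed

lemma poly_eq_if_eq_on_positive_nats:
  fixes p q :: "real poly"
  assumes "\<And>n. n > 0 \<Longrightarrow> poly p (real n) = poly q (real n)"
  shows "p = q"
proof (rule ccontr)
  assume "p \<noteq> q"
  then have "finite {x. poly (p - q) x = 0}"
    by (intro poly_roots_finite) simp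
  moreover have "real ` {0<..} \<subseteq> {x. poly (p - q) x = 0}"
    using assms by auto
  ultimately have "finite (real ` {0<..})"
    by (rule finite_subset[rotated])
  then have "finite {0::nat<..}"
    by (rule finite_imageD) simp
  then show False by (simp add: infinite_Ioi)
qed

section \<open>Binomial coefficients as polynomials in the upper argument\<close>

text \<open>For \<open>m > 0\<close> this is \<open>(n choose m) / n\<close>: the factor
  \<open>n\<close> coming from \<open>i = 0\<close> is left out.\<close>

definition binomial_quotient_poly :: "nat \<Rightarrow> real poly" where
  "binomial_quotient_poly m = smult (1 / fact m) (\<Prod>i = 1..<m. [:- real i, 1:])"

lemma binomial_eq_poly:
  assumes "m > 0"
  shows "real (n choose m) = real n * poly (binomial_quotient_poly m) (real n)"
proof -
  have "real (n choose m) = (\<Prod>i = 0..<m. real n - real i) / fact m"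
    by (simp add: binomial_gbinomial gbinomial_prod_rev)
  also have "{0..<m} = insert 0 {1..<m}" using assms by auto
  finally show ?thesis
    by (simp add: binomial_quotient_poly_def poly_prod)
qed

text \<open>The factors \<open>- i\<close> multiply to \<open>(-1) ^ (m - 1) * (m - 1)!\<close>.
  This is where the weights \<open>(-1) ^ m / m\<close> in \<open>G\<close> are recognised.\<close>

lemma binomial_quotient_poly_0:
  assumes "m > 0"
  shows "poly (binomial_quotient_poly m) 0 = - ((- 1) ^ m / real m)"
proof -
  obtain r where m: "m = Suc r" using assms by (cases m) auto
  have "(\<Prod>i = 1..<Suc r. - real i) = (- 1) ^ r * fact r"
  proof (induction r)
    case (Suc r)
    have "(\<Prod>i = 1..<Suc (Suc r). - real i) = (\<Prod>i = 1..<Suc r. - real i) * - real (Suc r)"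
      by (rule prod.atLeastLessThan_Suc) simp
    with Suc.IH show ?case by (simp del: prod.op_ivl_Suc add: algebra_simps)
  qed simp
  then show ?thesis
    by (simp add: binomial_quotient_poly_def poly_prod m del: prod.op_ivl_Suc)
qed

text \<open>The alternating sum \<open>\<Sum>m. (-1)^m / m * P m\<close> reads off minus the linear coefficient of the
  polynomial \<open>n \<mapsto> \<Sum>m. (n choose m) * P m\<close>.\<close>

lemma alternating_sum_eq_linear_coefficient:
  fixes P :: "nat \<Rightarrow> real" and p :: "real poly"
  assumes "\<And>n. n > 0 \<Longrightarrow> (\<Sum>m = 1..l. real (n choose m) * P m) = real n * poly p (real n)"
  shows "(\<Sum>m = 1..l. (- 1) ^ m / real m * P m) = - poly p 0"
proof -
  define q where "q = (\<Sum>m = 1..l. smult (P m) (binomial_quotient_poly m))"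
  have "q = p"
  proof (rule poly_eq_if_eq_on_positive_nats)
    fix n :: nat assume n: "n > 0"
    have "real n * poly q (real n) = (\<Sum>m = 1..l. real (n choose m) * P m)"
      by (simp add: q_def poly_sum sum_distrib_left binomial_eq_poly mult_ac)
    then show "poly q (real n) = poly p (real n)"
      using assms[OF n] n by simp
  qed
  moreover have "poly q 0 = - (\<Sum>m = 1..l. (- 1) ^ m / real m * P m)"
    by (simp add: q_def poly_sum binomial_quotient_poly_0 sum_negf[symmetric] mult.commute)
  ultimately show ?thesis by simp
qed

section \<open>From compositions to surjections\<close>

definition surjections :: "'a set \<Rightarrow> nat set \<Rightarrow> ('a \<Rightarrow> nat) set" where
  "surjections A I = {f \<in> A \<rightarrow>\<^sub>E I. f ` A = I}"

lemma running_max_relabel: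
  assumes A: "finite A" and f: "f ` A = {..<m}"
    and h: "strict_mono_on {..<m} h" "h ` {..<m} \<subseteq> {..<n}"
  shows "running_max (block_sum k A (restrict (h \<circ> f) A)) n = running_max (block_sum k A f) m"
proof -
  let ?s = "\<lambda>f t. \<Sum>a | a \<in> A \<and> f a < t. k a"
  have cong: "?s (restrict (h \<circ> f) A) t = ?s f t'"
    if "\<And>i. i < m \<Longrightarrow> h i < t \<longleftrightarrow> i < t'" for t t'
  proof -
    have "f a < m" if "a \<in> A" for a using f that by auto
    with that show ?thesis by (intro sum.cong) auto
  qed
  have "?s (restrict (h \<circ> f) A) ` {..n} = ?s f ` {..m}"
  proof (intro equalityI subsetI)
    fix y assume "y \<in> ?s (restrict (h \<circ> f) A) ` {..n}"
    then obtain t where y: "y = ?s (restrict (h \<circ> f) A) t" by auto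
    \<comment> \<open>As \<open>h\<close> is increasing, \<open>t'\<close> counts the labels
      \<open>i < m\<close> with \<open>h i < t\<close>.\<close>
    define t' where "t' = (LEAST i. i \<ge> m \<or> t \<le> h i)"
    have t': "t' \<ge> m \<or> t \<le> h t'"
      unfolding t'_def by (rule LeastI[of _ m]) simp
    have "t' \<le> m"
      unfolding t'_def by (rule Least_le) simp
    have "h i < t \<longleftrightarrow> i < t'" if "i < m" for i
    proof
      assume "i < t'"
      then show "h i < t"
        using not_less_Least[of i "\<lambda>i. i \<ge> m \<or> t \<le> h i"] unfolding t'_def by auto
    next
      assume "h i < t"
      show "i < t'"
      proof (rule ccontr)
        assume "\<not> i < t'"
        with \<open>i < m\<close> have "t' < m" "h t' \<le> h i"
          using strict_mono_on_leD[OF h(1), of t' i] by auto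
        with t' \<open>h i < t\<close> show False by auto
      qed
    qed
    then have "y = ?s f t'" unfolding y by (rule cong)
    with \<open>t' \<le> m\<close> show "y \<in> ?s f ` {..m}" by auto
  next
    fix y assume "y \<in> ?s f ` {..m}"
    then obtain t' where y: "y = ?s f t'" and "t' \<le> m" by auto
    define t where "t = (if t' < m then h t' else n)"
    have "h i < t \<longleftrightarrow> i < t'" if "i < m" for i
      using that h(2) \<open>t' \<le> m\<close> strict_mono_on_less[OF h(1), of i t'] by (auto simp: t_def)
    then have "y = ?s (restrict (h \<circ> f) A) t" unfolding y by (rule cong[symmetric])
    moreover have "t \<le> n" using h(2) by (auto simp: t_def image_subset_iff less_imp_le)
    ultimately show "y \<in> ?s (restrict (h \<circ> f) A) ` {..n}" by auto
  qed
  then show ?thesis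
    by (simp add: running_max_def sum_block_sum[OF A])
qed

lemma sum_surjections_relabel:
  assumes A: "finite A" and I: "I \<subseteq> {..<n}"
  shows "(\<Sum>f\<in>surjections A I. running_max (block_sum k A f) n) =
    (\<Sum>f\<in>surjections A {..<card I}. running_max (block_sum k A f) (card I))"
proof -
  have "finite I" using I by (rule finite_subset) simp
  then obtain h where h: "bij_betw h {..<card I} I" "strict_mono_on {..<card I} h"
    by (rule ex_bij_betw_strict_mono_card)
  let ?h' = "inv_into {..<card I} h"
  have hI: "h ` {..<card I} = I" and inj: "inj_on h {..<card I}"
    using h(1) by (auto simp: bij_betw_def)
  have inv1: "?h' (h i) = i" if "i < card I" for i
    using inv_into_f_f[OF inj] that by simp
  have inv2: "h (?h' i) = i" if "i \<in> I" for i
    by (rule f_inv_into_f) (use that hI in simp)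
  have inv3: "?h' ` I = {..<card I}"
    using bij_betw_inv_into[OF h(1)] by (simp add: bij_betw_def)
  show ?thesis
  proof (rule sum.reindex_bij_witness[where i = "\<lambda>f. restrict (h \<circ> f) A" and j = "\<lambda>f. restrict (?h' \<circ> f) A"])
    fix f assume f: "f \<in> surjections A I"
    then have fA: "f ` A = I" "f \<in> extensional A" by (auto simp: surjections_def PiE_def)
    show eq: "restrict (h \<circ> restrict (?h' \<circ> f) A) A = f"
      using fA inv2 by (auto simp: fun_eq_iff restrict_def extensional_def)
    have "restrict (?h' \<circ> f) A ` A = ?h' ` (f ` A)" by auto
    then have im: "restrict (?h' \<circ> f) A ` A = {..<card I}"
      by (simp only: fA(1) inv3)
    from im show "restrict (?h' \<circ> f) A \<in> surjections A {..<card I}"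
      by (auto simp: surjections_def PiE_iff)
    show "running_max (block_sum k A (restrict (?h' \<circ> f) A)) (card I) = running_max (block_sum k A f) n"
      using running_max_relabel[OF A im h(2)] I hI unfolding eq by simp
  next
    fix f assume f: "f \<in> surjections A {..<card I}"
    then have fA: "f ` A = {..<card I}" "f \<in> extensional A" by (auto simp: surjections_def PiE_def)
    show "restrict (?h' \<circ> restrict (h \<circ> f) A) A = f"
      using fA inv1 by (auto simp: fun_eq_iff restrict_def extensional_def)
    have "restrict (h \<circ> f) A ` A = h ` (f ` A)" by auto
    then have "restrict (h \<circ> f) A ` A = I"
      by (simp only: fA(1) hI)
    then show "restrict (h \<circ> f) A \<in> surjections A I"
      by (auto simp: surjections_def PiE_iff)
  qed
qed

text \<open>Functions are sorted by their image \<open>I\<close>; the increasing enumeration of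
  \<open>I\<close> shows that its contribution depends on \<open>card I\<close> only.\<close>

lemma sum_running_max_surjections:
  assumes A: "finite A" "A \<noteq> {}"
  shows "(\<Sum>f \<in> A \<rightarrow>\<^sub>E {..<n}. running_max (block_sum k A f) n) =
    (\<Sum>m = 1..card A. real (n choose m) *
      (\<Sum>f\<in>surjections A {..<m}. running_max (block_sum k A f) m))"
proof -
  define P where "P m = (\<Sum>f\<in>surjections A {..<m}. running_max (block_sum k A f) m)" for m
  have empty: "P m = 0" if "m \<notin> {1..card A}" for m
  proof -
    have "f ` A \<noteq> {..<m}" for f
    proof
      assume f: "f ` A = {..<m}"
      then have "m \<le> card A" using card_image_le[OF A(1), of f] by simp
      moreover have "m \<noteq> 0" using f A(2) by auto
      ultimately show False using that by simp
    qed
    then have "surjections A {..<m} = {}" by (auto simp: surjections_def)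
    then show ?thesis by (simp add: P_def)
  qed
  have "(\<Sum>f \<in> A \<rightarrow>\<^sub>E {..<n}. running_max (block_sum k A f) n) =
      (\<Sum>I\<in>Pow {..<n}. \<Sum>f\<in>{f \<in> A \<rightarrow>\<^sub>E {..<n}. f ` A = I}. running_max (block_sum k A f) n)"
    by (rule sum.group[symmetric]) (use A in \<open>auto intro!: finite_PiE\<close>)
  also have "\<dots> = (\<Sum>I\<in>Pow {..<n}. P (card I))"
  proof (rule sum.cong[OF refl])
    fix I assume I: "I \<in> Pow {..<n}"
    then have "{f \<in> A \<rightarrow>\<^sub>E {..<n}. f ` A = I} = surjections A I"
      by (auto simp: surjections_def PiE_iff)
    with I show "(\<Sum>f\<in>{f \<in> A \<rightarrow>\<^sub>E {..<n}. f ` A = I}. running_max (block_sum k A f) n) = P (card I)"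
      using sum_surjections_relabel[OF A(1), of I n k] by (simp only: P_def Pow_iff)
  qed
  also have "\<dots> = (\<Sum>m\<le>n. \<Sum>I\<in>{I \<in> Pow {..<n}. card I = m}. P (card I))"
    by (rule sum.group[symmetric]) (auto dest: card_mono[rotated])
  also have "\<dots> = (\<Sum>m\<le>n. real (n choose m) * P m)"
  proof (rule sum.cong[OF refl])
    fix m
    have "(\<Sum>I\<in>{I \<in> Pow {..<n}. card I = m}. P (card I)) = (\<Sum>I\<in>{I. I \<subseteq> {..<n} \<and> card I = m}. P m)"
      by (rule sum.cong) auto
    then show "(\<Sum>I\<in>{I \<in> Pow {..<n}. card I = m}. P (card I)) = real (n choose m) * P m"
      by (simp add: n_subsets)
  qed
  \<comment> \<open>First the \<open>m\<close> without surjections are dropped, then those above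
    \<open>n\<close> are added, where the binomial coefficient is 0.\<close>
  also have "\<dots> = (\<Sum>m\<in>{..n} \<inter> {1..card A}. real (n choose m) * P m)"
    by (rule sum.mono_neutral_right) (auto simp: empty)
  also have "\<dots> = (\<Sum>m = 1..card A. real (n choose m) * P m)"
    by (rule sum.mono_neutral_left) auto
  finally show ?thesis by (simp add: P_def)
qed

section \<open>Counting permutations with a prescribed labelling\<close>

text \<open>A bijection matching labels is an independent choice of bijections between corresponding
  fibres. Domain and codomain are kept separate so that the induction can remove a point and its
  image, which may differ.\<close>

lemma card_label_preserving_bijections:
  assumes "finite S" "finite T" "finite I" "g ` S \<subseteq> I" "f ` T \<subseteq> I"
    and "\<And>i. i \<in> I \<Longrightarrow> card {x \<in> S. g x = i} = card {y \<in> T. f y = i}"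
  shows "card {\<sigma>. bij_betw \<sigma> S T \<and> (\<forall>x. x \<notin> S \<longrightarrow> \<sigma> x = x) \<and> (\<forall>x\<in>S. f (\<sigma> x) = g x)} =
    (\<Prod>i\<in>I. fact (card {x \<in> S. g x = i}))"
  using assms
proof (induction S arbitrary: T rule: finite_induct)
  case empty
  have "T = {}"
  proof (rule ccontr)
    assume "T \<noteq> {}"
    then obtain y where "y \<in> T" by auto
    with empty.prems have "card {z \<in> T. f z = f y} = 0" by fastforce
    with \<open>finite T\<close> \<open>y \<in> T\<close> show False by auto
  qed
  then have "{\<sigma>. bij_betw \<sigma> {} T \<and> (\<forall>x. x \<notin> {} \<longrightarrow> \<sigma> x = x) \<and> (\<forall>x\<in>{}. f (\<sigma> x) = g x)} = {id}"
    by (auto simp: fun_eq_iff)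
  then show ?case by simp
next
  case (insert a S)
  define B where "B S T = {\<sigma>. bij_betw \<sigma> S T \<and> (\<forall>x. x \<notin> S \<longrightarrow> \<sigma> x = x) \<and> (\<forall>x\<in>S. f (\<sigma> x) = g x)}" for S T
  define Y where "Y = {y \<in> T. f y = g a}"
  define c where "c i = card {x \<in> S. g x = i}" for i
  have c_insert: "card {x \<in> insert a S. g x = i} = (if i = g a then Suc (c i) else c i)" for i
  proof -
    have "{x \<in> insert a S. g x = i} = (if i = g a then insert a {x \<in> S. g x = i} else {x \<in> S. g x = i})"
      by auto
    with insert.hyps show ?thesis by (simp add: c_def)
  qed
  have "g a \<in> I" using insert.prems by auto
  then have Y: "card Y = Suc (c (g a))"
    using insert.prems(5)[of "g a"] c_insert[of "g a"] by (simp add: Y_def)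
  have "finite Y" using insert.prems by (simp add: Y_def)
  have IH: "card (B S (T - {y})) = (\<Prod>i\<in>I. fact (c i))" if "y \<in> Y" for y
    unfolding B_def c_def
  proof (rule insert.IH)
    fix i assume "i \<in> I"
    have T: "card {z \<in> T. f z = i} = (if i = g a then Suc (c i) else c i)"
      by (simp only: insert.prems(5)[OF \<open>i \<in> I\<close>, symmetric] c_insert)
    have "{z \<in> T - {y}. f z = i} = {z \<in> T. f z = i} - {y}" by auto
    then have "card {z \<in> T - {y}. f z = i} = c i"
      using that T by (cases "i = g a") (simp_all add: Y_def card_Diff_singleton_if)
    then show "card {x \<in> S. g x = i} = card {z \<in> T - {y}. f z = i}"
      by (simp only: c_def)
  next
    show "g ` S \<subseteq> I" "f ` (T - {y}) \<subseteq> I" "finite (T - {y})" "finite I"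
      using insert.prems(1-4) by blast+
  qed
  \<comment> \<open>A bijection is encoded by the image of \<open>a\<close> and its restriction to
    \<open>S\<close>; \<open>a\<close> is reset to itself because members of \<open>B S\<close> fix
    every point outside \<open>S\<close>.\<close>
  have "bij_betw (\<lambda>\<sigma>. (\<sigma> a, \<sigma>(a := a))) (B (insert a S) T) (SIGMA y:Y. B S (T - {y}))"
  proof (rule bij_betwI[where g = "\<lambda>(y, \<tau>). \<tau>(a := y)"])
    show "(\<lambda>\<sigma>. (\<sigma> a, \<sigma>(a := a))) \<in> B (insert a S) T \<rightarrow> (SIGMA y:Y. B S (T - {y}))"
    proof
      fix \<sigma> assume \<sigma>: "\<sigma> \<in> B (insert a S) T"
      then have bij: "bij_betw \<sigma> (insert a S) T" by (simp add: B_def)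
      then have "\<sigma> a \<in> T" by (auto simp: bij_betw_def)
      moreover have "bij_betw \<sigma> S (T - {\<sigma> a})"
        using bij notIn_Un_bij_betw3[of a S \<sigma> "T - {\<sigma> a}"] insert.hyps \<open>\<sigma> a \<in> T\<close>
        by (simp add: insert_absorb)
      then have "bij_betw (\<sigma>(a := a)) S (T - {\<sigma> a})"
        by (rule bij_betw_cong[THEN iffD1, rotated]) (use insert.hyps in auto)
      ultimately show "(\<sigma> a, \<sigma>(a := a)) \<in> (SIGMA y:Y. B S (T - {y}))"
        using \<sigma> insert.hyps by (auto simp: B_def Y_def)
    qed
    show "(\<lambda>(y, \<tau>). \<tau>(a := y)) \<in> (SIGMA y:Y. B S (T - {y})) \<rightarrow> B (insert a S) T"
    proof clarify
      fix y \<tau> assume y: "y \<in> Y" and \<tau>: "\<tau> \<in> B S (T - {y})"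
      have "bij_betw (\<tau>(a := y)) S (T - {y})"
        by (rule bij_betw_cong[THEN iffD1, of S \<tau>]) (use insert.hyps \<tau> in \<open>auto simp: B_def\<close>)
      then have "bij_betw (\<tau>(a := y)) (insert a S) T"
        using insert.hyps y by (auto simp: bij_betw_def Y_def)
      then show "\<tau>(a := y) \<in> B (insert a S) T"
        using \<tau> y insert.hyps by (auto simp: B_def Y_def)
    qed
  qed (use insert.hyps in \<open>auto simp: B_def fun_eq_iff\<close>)
  then have "card (B (insert a S) T) = card (SIGMA y:Y. B S (T - {y}))"
    by (rule bij_betw_same_card)
  also have "\<dots> = (\<Sum>y\<in>Y. card (B S (T - {y})))"
  proof (rule card_SigmaI[OF \<open>finite Y\<close>], rule ballI)
    fix y assume "y \<in> Y"
    show "finite (B S (T - {y}))"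
      by (rule card_ge_0_finite) (simp add: IH[OF \<open>y \<in> Y\<close>] prod_pos)
  qed
  also have "\<dots> = Suc (c (g a)) * (\<Prod>i\<in>I. fact (c i))"
    by (simp add: IH Y)
  \<comment> \<open>The fibre of \<open>g a\<close> grows by one, which multiplies its factorial by
    \<open>Suc (c (g a))\<close>.\<close>
  also have "\<dots> = (\<Prod>i\<in>I. fact (if i = g a then Suc (c i) else c i))"
    unfolding prod.remove[OF \<open>finite I\<close> \<open>g a \<in> I\<close>] by (simp add: algebra_simps)
  finally show ?case
    unfolding B_def c_insert .
qed

section \<open>Compositions as fibre sizes of labellings\<close>

definition fibre_sizes :: "'a set \<Rightarrow> nat \<Rightarrow> ('a \<Rightarrow> nat) \<Rightarrow> nat list" where
  "fibre_sizes A m f = map (\<lambda>i. card {a \<in> A. f a = i}) [0..<m]"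

lemma fibre_sizes_surjections:
  assumes "finite A" "f \<in> surjections A {..<m}"
  shows "fibre_sizes A m f \<in> compositions m (card A)"
proof -
  have f: "f ` A = {..<m}" using assms by (simp add: surjections_def)
  have "(\<Sum>i<m. \<Sum>a | a \<in> A \<and> f a = i. 1) = (\<Sum>a\<in>A. 1::nat)"
    by (rule sum.group) (use assms f in auto)
  then have "sum_list (fibre_sizes A m f) = card A"
    by (simp add: fibre_sizes_def interv_sum_list_conv_sum_set_nat atLeast0LessThan)
  moreover have "card {a \<in> A. f a = i} \<ge> 1" if "i < m" for i
  proof -
    have "i \<in> f ` A" using f that by simp
    then have "{a \<in> A. f a = i} \<noteq> {}" by auto
    then show ?thesis using assms(1) by (simp add: Suc_le_eq card_gt_0_iff)
  qed
  ultimately show ?thesis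
    by (auto simp: compositions_def fibre_sizes_def)
qed

text \<open>Positions are counted from 1, blocks from 0.\<close>

definition block_index :: "nat list \<Rightarrow> nat \<Rightarrow> nat" where
  "block_index ls i = (LEAST t. i \<le> sum_list (take (Suc t) ls))"

lemma sum_list_take_mono: "s \<le> t \<Longrightarrow> sum_list (take s ls) \<le> sum_list (take t (ls :: nat list))"
  by (metis le_add1 le_add_diff_inverse sum_list_append take_add)

lemma block_index_less_iff:
  assumes "1 \<le> i" "i \<le> sum_list ls"
  shows "block_index ls i < t \<longleftrightarrow> i \<le> sum_list (take t ls)"
proof
  have "i \<le> sum_list (take (Suc (length ls)) ls)" using assms by simp
  then have "i \<le> sum_list (take (Suc (block_index ls i)) ls)"
    unfolding block_index_def by (rule LeastI)
  moreover assume "block_index ls i < t"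
  ultimately show "i \<le> sum_list (take t ls)"
    using sum_list_take_mono[of "Suc (block_index ls i)" t ls] by simp
next
  assume *: "i \<le> sum_list (take t ls)"
  with assms(1) obtain s where s: "t = Suc s" by (cases t) auto
  with * have "block_index ls i \<le> s"
    unfolding block_index_def by (intro Least_le) simp
  with s show "block_index ls i < t" by simp
qed

lemma card_block_index:
  assumes "j < length ls"
  shows "card {i \<in> {1..sum_list ls}. block_index ls i = j} = ls ! j"
proof -
  have iff: "block_index ls i = j \<longleftrightarrow> sum_list (take j ls) < i \<and> i \<le> sum_list (take (Suc j) ls)"
    if "i \<in> {1..sum_list ls}" for i
    using block_index_less_iff[of i ls j] block_index_less_iff[of i ls "Suc j"] that by auto
  have le: "sum_list (take (Suc j) ls) \<le> sum_list ls"
    using sum_list_take_mono[of "Suc j" "max (Suc j) (length ls)" ls] by simp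
  have "{i \<in> {1..sum_list ls}. block_index ls i = j} =
      {sum_list (take j ls)<..sum_list (take (Suc j) ls)}"
  proof (rule set_eqI)
    fix i
    show "i \<in> {i \<in> {1..sum_list ls}. block_index ls i = j} \<longleftrightarrow>
        i \<in> {sum_list (take j ls)<..sum_list (take (Suc j) ls)}"
      using iff[of i] le by (cases "i \<in> {1..sum_list ls}") auto
  qed
  then show ?thesis
    using assms by (simp add: take_Suc_conv_app_nth)
qed

text \<open>The labelling sends \<open>a\<close> to the block that contains its position
  \<open>inv \<sigma> a\<close>, so the elements with label below \<open>t\<close> fill the first
  \<open>t\<close> blocks of the word \<open>\<sigma> 1, ..., \<sigma> l\<close>.\<close>

lemma max_partial_sum_eq_running_max:
  assumes \<sigma>: "\<sigma> permutes {1..l}" and ls: "ls \<in> compositions m l" and m: "m \<ge> 1"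
    and zero: "(\<Sum>i = 1..l. k i) = 0"
  shows "max_partial_sum k \<sigma> ls =
    running_max (block_sum k {1..l} (restrict (block_index ls \<circ> inv \<sigma>) {1..l})) m"
proof -
  let ?f = "restrict (block_index ls \<circ> inv \<sigma>) {1..l}"
  have len: "length ls = m" and sum: "sum_list ls = l"
    using ls by (auto simp: compositions_def)
  let ?s = "\<lambda>t. \<Sum>i = 1..sum_list (take t ls). k (\<sigma> i)"
  have below: "(\<Sum>i<t. block_sum k {1..l} ?f i) = ?s t" for t
  proof -
    have "sum_list (take t ls) \<le> l"
      using sum_list_take_mono[of t "max t (length ls)" ls] sum by simp
    then have block: "i \<in> {1..l} \<and> block_index ls i < t \<longleftrightarrow> i \<in> {1..sum_list (take t ls)}" for i
      using block_index_less_iff[of i ls t] sum by auto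
    have "(\<Sum>i<t. block_sum k {1..l} ?f i) = (\<Sum>a | a \<in> {1..l} \<and> ?f a < t. k a)"
      by (rule sum_block_sum) simp
    also have "\<dots> = ?s t"
    proof (rule sum.reindex_bij_witness[where i = \<sigma> and j = "inv \<sigma>"])
      fix i assume "i \<in> {1..sum_list (take t ls)}"
      then show "\<sigma> i \<in> {a. a \<in> {1..l} \<and> ?f a < t}"
        using block[of i] permutes_in_image[OF \<sigma>] permutes_inverses[OF \<sigma>] by auto
    next
      fix a assume "a \<in> {a. a \<in> {1..l} \<and> ?f a < t}"
      then have a: "a \<in> {1..l}" "block_index ls (inv \<sigma> a) < t" by auto
      then have "inv \<sigma> a \<in> {1..l}" by (simp only: permutes_in_image[OF permutes_inv[OF \<sigma>]])
      with a(2) show "inv \<sigma> a \<in> {1..sum_list (take t ls)}"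
        using block[of "inv \<sigma> a"] by blast
    qed (simp_all add: permutes_inverses[OF \<sigma>])
    finally show ?thesis .
  qed
  have "?s m = sum k {1..l}"
    using sum.permute[OF \<sigma>, of k] len sum by simp
  then have "?s m = 0" using zero by simp
  \<comment> \<open>The indices 0 and \<open>m\<close> both give the value 0, which
    \<open>max_partial_sum\<close> inserts explicitly.\<close>
  moreover have "{..m} = {0, m} \<union> {1..<m}" using m by auto
  ultimately have "?s ` {..m} = insert 0 (?s ` {1..<m})"
    by (simp add: image_Un)
  then show ?thesis
    unfolding running_max_def max_partial_sum_def below len by simp
qed

text \<open>An orbit-stabiliser count: the labellings \<open>g \<circ> inv \<sigma>\<close> run
  through all labellings with the fibre sizes of \<open>g\<close>, each hit by as many
  \<open>\<sigma>\<close> as the product of the factorials of these sizes.\<close>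

lemma sum_permutations_by_fibres:
  fixes \<phi> :: "('a \<Rightarrow> nat) \<Rightarrow> real"
  assumes A: "finite A" and g: "g ` A \<subseteq> {..<m}"
  shows "(\<Sum>\<sigma> | \<sigma> permutes A. \<phi> (restrict (g \<circ> inv \<sigma>) A)) =
    (\<Prod>i<m. fact (card {a \<in> A. g a = i})) *
    (\<Sum>f | f \<in> A \<rightarrow>\<^sub>E {..<m} \<and> fibre_sizes A m f = fibre_sizes A m g. \<phi> f)"
proof -
  let ?T = "{f \<in> A \<rightarrow>\<^sub>E {..<m}. fibre_sizes A m f = fibre_sizes A m g}"
  let ?r = "\<lambda>\<sigma>. restrict (g \<circ> inv \<sigma>) A"
  have sizes: "fibre_sizes A m f = fibre_sizes A m g \<longleftrightarrow>
      (\<forall>i<m. card {a \<in> A. f a = i} = card {a \<in> A. g a = i})" for f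
    by (auto simp: fibre_sizes_def)
  have in_T: "?r \<sigma> \<in> ?T" if \<sigma>: "\<sigma> permutes A" for \<sigma>
  proof -
    have "card {a \<in> A. ?r \<sigma> a = i} = card {a \<in> A. g a = i}" for i
    proof (rule bij_betw_same_card[of "inv \<sigma>"], rule bij_betwI[where g = \<sigma>])
      show "inv \<sigma> \<in> {a \<in> A. ?r \<sigma> a = i} \<rightarrow> {a \<in> A. g a = i}"
        using permutes_in_image[OF permutes_inv[OF \<sigma>]] by auto
      show "\<sigma> \<in> {a \<in> A. g a = i} \<rightarrow> {a \<in> A. ?r \<sigma> a = i}"
        using permutes_in_image[OF \<sigma>] permutes_inverses[OF \<sigma>] by auto
    qed (simp_all add: permutes_inverses[OF \<sigma>])
    moreover have "?r \<sigma> \<in> A \<rightarrow>\<^sub>E {..<m}"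
      using g permutes_in_image[OF permutes_inv[OF \<sigma>]] by (auto simp: PiE_iff)
    ultimately show ?thesis by (simp add: sizes)
  qed
  have "finite (A \<rightarrow>\<^sub>E {..<m})" using A by (intro finite_PiE) auto
  then have "finite ?T" by simp
  then have "(\<Sum>\<sigma> | \<sigma> permutes A. \<phi> (?r \<sigma>)) =
      (\<Sum>f\<in>?T. \<Sum>\<sigma>\<in>{\<sigma>. \<sigma> \<in> {\<sigma>. \<sigma> permutes A} \<and> ?r \<sigma> = f}. \<phi> (?r \<sigma>))"
    by (intro sum.group[symmetric] finite_permutations A image_subsetI) (assumption, rule in_T, simp)
  also have "\<dots> = (\<Sum>f\<in>?T. (\<Prod>i<m. fact (card {a \<in> A. g a = i})) * \<phi> f)"
  proof (rule sum.cong[OF refl])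
    fix f assume f: "f \<in> ?T"
    \<comment> \<open>Rewriting \<open>g \<circ> inv \<sigma> = f\<close> as
      \<open>f \<circ> \<sigma> = g\<close> on \<open>A\<close> makes
      \<open>card_label_preserving_bijections\<close> applicable.\<close>
    have "\<sigma> permutes A \<and> ?r \<sigma> = f \<longleftrightarrow>
        bij_betw \<sigma> A A \<and> (\<forall>x. x \<notin> A \<longrightarrow> \<sigma> x = x) \<and> (\<forall>x\<in>A. f (\<sigma> x) = g x)" for \<sigma>
    proof (intro iffI conjI; (elim conjE)?)
      assume \<sigma>: "\<sigma> permutes A" and r: "?r \<sigma> = f"
      show "bij_betw \<sigma> A A" using \<sigma> by (rule permutes_imp_bij)
      show "\<forall>x. x \<notin> A \<longrightarrow> \<sigma> x = x" using permutes_not_in[OF \<sigma>] by blast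
      show "\<forall>x\<in>A. f (\<sigma> x) = g x"
        unfolding r[symmetric] using permutes_in_image[OF \<sigma>] permutes_inverses[OF \<sigma>] by auto
    next
      assume \<sigma>: "bij_betw \<sigma> A A" "\<forall>x. x \<notin> A \<longrightarrow> \<sigma> x = x" "\<forall>x\<in>A. f (\<sigma> x) = g x"
      show perm: "\<sigma> permutes A" using \<sigma> by (intro bij_imp_permutes) auto
      show "?r \<sigma> = f"
      proof
        fix x
        show "?r \<sigma> x = f x"
        proof (cases "x \<in> A")
          case True
          then have "inv \<sigma> x \<in> A" by (simp only: permutes_in_image[OF permutes_inv[OF perm]])
          with \<sigma>(3) have "f (\<sigma> (inv \<sigma> x)) = g (inv \<sigma> x)" by blast
          with True show ?thesis by (simp add: permutes_inverses[OF perm])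
        next
          case False
          from f have "f \<in> extensional A" by (simp add: PiE_def)
          with False show ?thesis by (simp add: extensional_arb[of f])
        qed
      qed
    qed
    then have "{\<sigma>. \<sigma> \<in> {\<sigma>. \<sigma> permutes A} \<and> ?r \<sigma> = f} =
        {\<sigma>. bij_betw \<sigma> A A \<and> (\<forall>x. x \<notin> A \<longrightarrow> \<sigma> x = x) \<and> (\<forall>x\<in>A. f (\<sigma> x) = g x)}"
      by simp
    also have "card \<dots> = (\<Prod>i<m. fact (card {a \<in> A. g a = i}))"
      by (rule card_label_preserving_bijections) (use A f g in \<open>auto simp: sizes\<close>)
    finally have "real (card {\<sigma>. \<sigma> \<in> {\<sigma>. \<sigma> permutes A} \<and> ?r \<sigma> = f}) =
        (\<Prod>i<m. fact (card {a \<in> A. g a = i}))"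
      by simp
    moreover have "(\<Sum>\<sigma>\<in>{\<sigma>. \<sigma> \<in> {\<sigma>. \<sigma> permutes A} \<and> ?r \<sigma> = f}. \<phi> (?r \<sigma>)) =
        real (card {\<sigma>. \<sigma> \<in> {\<sigma>. \<sigma> permutes A} \<and> ?r \<sigma> = f}) * \<phi> f"
      by simp
    ultimately show "(\<Sum>\<sigma>\<in>{\<sigma>. \<sigma> \<in> {\<sigma>. \<sigma> permutes A} \<and> ?r \<sigma> = f}. \<phi> (?r \<sigma>)) =
        (\<Prod>i<m. fact (card {a \<in> A. g a = i})) * \<phi> f"
      by simp
  qed
  finally show ?thesis
    by (simp only: sum_distrib_left)
qed

text \<open>The factor \<open>1 / (\<Prod>x\<leftarrow>ls. fact x)\<close> cancels the multiplicity
  of each labelling; summing over \<open>ls\<close> then sorts the surjections by their fibre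
  sizes.\<close>

lemma sum_compositions_eq_sum_surjections:
  assumes m: "m \<ge> 1" and zero: "(\<Sum>i = 1..l. k i) = 0"
  shows "(\<Sum>\<sigma> | \<sigma> permutes {1..l}. \<Sum>ls\<in>compositions m l.
      1 / (\<Prod>x\<leftarrow>ls. fact x) * max_partial_sum k \<sigma> ls) =
    (\<Sum>f\<in>surjections {1..l} {..<m}. running_max (block_sum k {1..l} f) m)"
proof -
  let ?\<phi> = "\<lambda>f. running_max (block_sum k {1..l} f) m"
  let ?T = "\<lambda>ls. {f \<in> {1..l} \<rightarrow>\<^sub>E {..<m}. fibre_sizes {1..l} m f = ls}"
  have fibre_sum: "(\<Sum>\<sigma> | \<sigma> permutes {1..l}. 1 / (\<Prod>x\<leftarrow>ls. fact x) * max_partial_sum k \<sigma> ls) =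
      (\<Sum>f\<in>{f \<in> surjections {1..l} {..<m}. fibre_sizes {1..l} m f = ls}. ?\<phi> f)"
    if ls: "ls \<in> compositions m l" for ls
  proof -
    have len: "length ls = m" and sum: "sum_list ls = l" and pos: "\<And>x. x \<in> set ls \<Longrightarrow> x \<ge> 1"
      using ls by (auto simp: compositions_def)
    have g: "block_index ls ` {1..l} \<subseteq> {..<m}"
      using block_index_less_iff[of _ ls m] len sum by auto
    have sizes: "fibre_sizes {1..l} m (block_index ls) = ls"
      using card_block_index[of _ ls] len sum by (intro nth_equalityI) (simp_all add: fibre_sizes_def)
    have "(\<Prod>x\<leftarrow>ls. fact x) = (\<Prod>i<m. fact (ls ! i) :: real)"
      by (simp add: prod.list_conv_set_nth len atLeast0LessThan)
    also have "\<dots> = (\<Prod>i<m. fact (card {a \<in> {1..l}. block_index ls a = i}))"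
      using card_block_index[of _ ls] len sum by (intro prod.cong) auto
    finally have fact_eq: "(\<Prod>x\<leftarrow>ls. fact x) =
        (\<Prod>i<m. fact (card {a \<in> {1..l}. block_index ls a = i}) :: real)" .
    have nz: "(\<Prod>i<m. fact (card {a \<in> {1..l}. block_index ls a = i}) :: real) \<noteq> 0"
      by simp
    have "(\<Sum>\<sigma> | \<sigma> permutes {1..l}. max_partial_sum k \<sigma> ls) =
        (\<Sum>\<sigma> | \<sigma> permutes {1..l}. ?\<phi> (restrict (block_index ls \<circ> inv \<sigma>) {1..l}))"
      by (rule sum.cong) (use max_partial_sum_eq_running_max[OF _ ls m zero] in auto)
    also have "\<dots> = (\<Prod>x\<leftarrow>ls. fact x) * (\<Sum>f\<in>?T ls. ?\<phi> f)"
      unfolding fact_eq using sum_permutations_by_fibres[OF finite_atLeastAtMost g, of ?\<phi>]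
      by (simp only: sizes)
    finally have "(\<Sum>\<sigma> | \<sigma> permutes {1..l}. 1 / (\<Prod>x\<leftarrow>ls. fact x) * max_partial_sum k \<sigma> ls) =
        (\<Sum>f\<in>?T ls. ?\<phi> f)"
      using nz unfolding sum_distrib_left[symmetric] fact_eq by simp
    \<comment> \<open>All parts of a composition are at least 1, so a function with fibre sizes
      \<open>ls\<close> misses no label.\<close>
    moreover have "?T ls = {f \<in> surjections {1..l} {..<m}. fibre_sizes {1..l} m f = ls}"
    proof -
      have "f ` {1..l} = {..<m}" if f: "f \<in> {1..l} \<rightarrow>\<^sub>E {..<m}" "fibre_sizes {1..l} m f = ls" for f
      proof
        show "f ` {1..l} \<subseteq> {..<m}" using f by auto
        show "{..<m} \<subseteq> f ` {1..l}"
        proof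
          fix i assume "i \<in> {..<m}"
          then have "card {a \<in> {1..l}. f a = i} \<in> set ls"
            unfolding f(2)[symmetric] fibre_sizes_def by auto
          then have "card {a \<in> {1..l}. f a = i} \<ge> 1" by (rule pos)
          then have "{a \<in> {1..l}. f a = i} \<noteq> {}" by (metis card.empty not_one_le_zero)
          then show "i \<in> f ` {1..l}" by auto
        qed
      qed
      then show ?thesis by (auto simp: surjections_def)
    qed
    ultimately show ?thesis by simp
  qed
  have fin: "finite (surjections {1..l} {..<m})"
    unfolding surjections_def by (rule finite_subset[OF _ finite_PiE[of "{1..l}" "\<lambda>_. {..<m}"]]) auto
  have "(\<Sum>\<sigma> | \<sigma> permutes {1..l}. \<Sum>ls\<in>compositions m l.
      1 / (\<Prod>x\<leftarrow>ls. fact x) * max_partial_sum k \<sigma> ls) =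
    (\<Sum>ls\<in>compositions m l. \<Sum>f\<in>{f \<in> surjections {1..l} {..<m}. fibre_sizes {1..l} m f = ls}. ?\<phi> f)"
    by (subst sum.swap) (rule sum.cong[OF refl fibre_sum])
  also have "\<dots> = (\<Sum>f\<in>surjections {1..l} {..<m}. ?\<phi> f)"
    by (rule sum.group[OF fin finite_compositions])
       (use fibre_sizes_surjections[of "{1..l}"] in auto)
  finally show ?thesis .
qed

section \<open>Evaluation of \<open>G\<close>\<close>

lemma G_eq_sum_surjections:
  assumes "(\<Sum>i = 1..l. k i) = 0"
  shows "G l k = (\<Sum>m = 1..l. (- 1) ^ m / real m *
    (\<Sum>f\<in>surjections {1..l} {..<m}. running_max (block_sum k {1..l} f) m))"
proof -
  have "G l k = (\<Sum>m = 1..l. \<Sum>\<sigma> | \<sigma> permutes {1..l}. (- 1) ^ m / real m *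
      (\<Sum>ls\<in>compositions m l. 1 / (\<Prod>x\<leftarrow>ls. fact x) * max_partial_sum k \<sigma> ls))"
    unfolding G_def by (rule sum.swap)
  also have "\<dots> = (\<Sum>m = 1..l. (- 1) ^ m / real m *
      (\<Sum>f\<in>surjections {1..l} {..<m}. running_max (block_sum k {1..l} f) m))"
    unfolding sum_distrib_left[symmetric]
    by (rule sum.cong[OF refl], subst sum_compositions_eq_sum_surjections[OF _ assms]) auto
  finally show ?thesis .
qed

text \<open>The polynomial attached to \<open>U\<close> has exponents \<open>card U - 1\<close> and
  \<open>card ({1..l} - U) - 1\<close>; its value at 0 is nonzero only if both are 0.\<close>

lemma G_eq_sum_singletons:
  assumes "l \<ge> 1" and zero: "(\<Sum>i = 1..l. k i) = 0"
  shows "G l k = 1 / 4 * (\<Sum>U | U \<subset> {1..l} \<and> card U = 1 \<and> card ({1..l} - U) = 1. \<bar>sum k U\<bar>)"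
proof -
  let ?A = "{1..l}"
  let ?V = "Pow ?A - {{}, ?A}"
  define c :: "nat \<Rightarrow> nat \<Rightarrow> real poly" where
    "c a b = (SOME p. poly p 0 = (if a = 0 \<and> b = 0 then - 1 else 0) \<and>
      (\<forall>n>0. poly p (real n) = (\<Sum>j = 1..<n. real j ^ a * real (n - j) ^ b)))" for a b
  have c0: "poly (c a b) 0 = (if a = 0 \<and> b = 0 then - 1 else 0)"
    and c: "n > 0 \<Longrightarrow> poly (c a b) (real n) = (\<Sum>j = 1..<n. real j ^ a * real (n - j) ^ b)" for a b n
    using someI_ex[OF power_convolution_poly[of a b], folded c_def] by blast+
  define p where "p = (\<Sum>U\<in>?V. smult (\<bar>sum k U\<bar> / 4) (c (card U - 1) (card (?A - U) - 1)))"
  have "G l k = - poly p 0"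
    unfolding G_eq_sum_surjections[OF zero]
  proof (rule alternating_sum_eq_linear_coefficient)
    fix n :: nat assume n: "n > 0"
    have "(\<Sum>m = 1..l. real (n choose m) *
        (\<Sum>f\<in>surjections ?A {..<m}. running_max (block_sum k ?A f) m)) =
      (\<Sum>f \<in> ?A \<rightarrow>\<^sub>E {..<n}. running_max (block_sum k ?A f) n)"
      using sum_running_max_surjections[of ?A k n] \<open>l \<ge> 1\<close> by simp
    also have "\<dots> = real n * poly p (real n)"
      unfolding sum_running_max[OF finite_atLeastAtMost zero] p_def
      by (simp add: poly_sum c[OF n] sum_distrib_left)
    finally show "(\<Sum>m = 1..l. real (n choose m) *
        (\<Sum>f\<in>surjections ?A {..<m}. running_max (block_sum k ?A f) m)) = real n * poly p (real n)" .
  qed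
  also have "poly p 0 = (\<Sum>U\<in>?V. if card U = 1 \<and> card (?A - U) = 1 then - \<bar>sum k U\<bar> / 4 else 0)"
    unfolding p_def poly_sum
  proof (rule sum.cong[OF refl])
    fix U assume "U \<in> ?V"
    then have "finite U" "U \<noteq> {}" "?A - U \<noteq> {}" by (auto intro: finite_subset)
    then have "card U \<noteq> 0" "card (?A - U) \<noteq> 0" by auto
    then have "card U - 1 = 0 \<longleftrightarrow> card U = 1" "card (?A - U) - 1 = 0 \<longleftrightarrow> card (?A - U) = 1"
      by linarith+
    then show "poly (smult (\<bar>sum k U\<bar> / 4) (c (card U - 1) (card (?A - U) - 1))) 0 =
        (if card U = 1 \<and> card (?A - U) = 1 then - \<bar>sum k U\<bar> / 4 else 0)"
      by (simp only: poly_smult c0) simp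
  qed
  also have "\<dots> = (\<Sum>U\<in>{U \<in> ?V. card U = 1 \<and> card (?A - U) = 1}. - \<bar>sum k U\<bar> / 4)"
    by (rule sum.inter_filter[symmetric]) simp
  also have "{U \<in> ?V. card U = 1 \<and> card (?A - U) = 1} = {U. U \<subset> ?A \<and> card U = 1 \<and> card (?A - U) = 1}"
    by (rule Collect_cong) (metis DiffE DiffI Pow_iff card.empty empty_iff insert_iff psubset_eq zero_neq_one)
  finally show ?thesis
    by (simp only: sum_divide_distrib[symmetric] sum_negf)
qed

theorem mainTheorem2:
  fixes l :: nat and k :: "nat \<Rightarrow> real"
  assumes "l \<ge> 2"
    and "(\<Sum>i = 1..l. k i) = 0"
  shows "(l = 2 \<longrightarrow> G l k = 1 / 2 * \<bar>k 1\<bar> \<and> 1 / 2 * \<bar>k 1\<bar> = 1 / 2 * \<bar>k 2\<bar>)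
       \<and> (l > 2 \<longrightarrow> G l k = 0)"
proof (intro conjI impI)
  let ?S = "{U. U \<subset> {1..l} \<and> card U = 1 \<and> card ({1..l} - U) = 1}"
  have G: "G l k = 1 / 4 * (\<Sum>U\<in>?S. \<bar>sum k U\<bar>)"
    using assms by (intro G_eq_sum_singletons) auto
  {
    assume l: "l = 2"
    then have A: "{1..l} = {1, 2}" by auto
    have "sum k {1, 2} = 0" using assms(2) by (simp only: A)
    then have "k 1 + k 2 = 0" by simp
    then show k12: "1 / 2 * \<bar>k 1\<bar> = 1 / 2 * \<bar>k 2\<bar>" by simp
    have "?S = {{1}, {2}}"
      unfolding A
    proof (intro equalityI subsetI)
      fix U :: "nat set" assume U: "U \<in> {U. U \<subset> {1, 2} \<and> card U = 1 \<and> card ({1, 2} - U) = 1}"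
      then obtain x where "U = {x}" by (auto simp: card_1_singleton_iff)
      with U show "U \<in> {{1}, {2}}" by auto
    qed (auto simp: insert_Diff_if)
    then have "G l k = 1 / 4 * (\<Sum>U\<in>{{1}, {2}}. \<bar>sum k U\<bar>)" by (simp only: G)
    also have "\<dots> = 1 / 4 * (\<bar>k 1\<bar> + \<bar>k 2\<bar>)" by simp
    also have "\<bar>k 2\<bar> = \<bar>k 1\<bar>" using k12 by simp
    finally show "G l k = 1 / 2 * \<bar>k 1\<bar>" by simp
  next
    assume l: "l > 2"
    \<comment> \<open>The complement of a singleton has \<open>l - 1 > 1\<close> elements.\<close>
    have "U \<notin> ?S" for U
    proof
      assume U: "U \<in> ?S"
      then have "card ({1..l} - U) = card {1..l} - card U"
        by (intro card_Diff_subset) (auto intro: finite_subset)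
      with U l show False by simp
    qed
    then have "?S = {}" by blast
    then show "G l k = 0" by (simp only: G sum.empty mult_zero_right)
  }
qed

end
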